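(* Pure parity information does not identify hull edges: there exist two simple polygons $P$ and $P'$ with vertices in general position, with the same number of vertices labeled in counterclockwise order, such that $P$ and $P'$ have identical pure parity information, but the set of label pairs that are edges of the convex hull of $P$ differs from the set of label pairs that are edges of the convex hull of $P'$, and the set of label pairs that are visibility edges of $P$ differs from the set of label pairs that are visibility edges of $P'$.
   Context: Polygons are simple polygons in the plane with vertices in general position (no three collinear), labeled by consecutive indices increasing in a counterclockwise traversal of the boundary. For an ordered pair of distinct vertices $(x,y)$ of $P$, let $L$ be the line through them; $L\setminus\{x,y\}$ has three components. $\mathrm{Tail}(x,y)$, $\mathrm{Body}(x,y)$, $\mathrm{Head}(x,y)$ denote the number of edges of $P$ that cross, respectively, the open ray of $L$ ending at $x$ and not containing $y$, the open segment between $x$ and $y$, and the open ray of $L$ starting at $y$ and not containing $x$. (If $xy$ is itself an edge of $P$, this edge is not counted.) The pure parity information of $P$ is the collection of the parities (even or odd) of $\mathrm{Tail}(x,y),\mathrm{Body}(x,y),\mathrm{Head}(x,y)$ for all pairs of vertices, indexed by the vertex labels. A pair $xy$ is a visibility edge if $\mathrm{Body}(x,y)=0$. *)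

theory Defs
  imports "HOL-Complex_Analysis.Complex_Analysis"
begin

text \<open>A polygon is given by the list of its vertices, as points of the Euclidean plane \<open>complex\<close>;
  the label of a vertex is its position in the list.\<close>

fun polyline :: "complex list \<Rightarrow> real \<Rightarrow> complex" where
  "polyline [] = linepath 0 0"
| "polyline [v] = linepath v v"
| "polyline [v, w] = linepath v w"
| "polyline (v # w # u # vs) = linepath v w +++ polyline (w # u # vs)"

definition boundary_path :: "complex list \<Rightarrow> real \<Rightarrow> complex" where
  "boundary_path P = polyline (P @ [hd P])"

definition simple_polygon :: "complex list \<Rightarrow> bool" where
  "simple_polygon P \<longleftrightarrow> length P \<ge> 3 \<and> simple_path (boundary_path P)"

definition general_position :: "complex list \<Rightarrow> bool" where
  "general_position P \<longleftrightarrow>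
    (\<forall>i<length P. \<forall>j<length P. \<forall>k<length P.
       i \<noteq> j \<and> j \<noteq> k \<and> i \<noteq> k \<longrightarrow> \<not> collinear {P ! i, P ! j, P ! k})"

definition counterclockwise :: "complex list \<Rightarrow> bool" where
  "counterclockwise P \<longleftrightarrow>
    (\<forall>z \<in> inside (path_image (boundary_path P)). winding_number (boundary_path P) z = 1)"

definition polygon_edge :: "complex list \<Rightarrow> nat \<Rightarrow> complex set" where
  "polygon_edge P k = closed_segment (P ! k) (P ! (Suc k mod length P))"

text \<open>In general position, an edge other than the pair \<open>i, j\<close> itself that meets one of the three
  open components of the line through the vertices \<open>i\<close> and \<open>j\<close> has both end points off that line,
  so that meeting the component is the same as crossing it.\<close>

definition crossings :: "complex list \<Rightarrow> nat \<Rightarrow> nat \<Rightarrow> complex set \<Rightarrow> nat" where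
  "crossings P i j R =
    card {k. k < length P \<and> {k, Suc k mod length P} \<noteq> {i, j} \<and> polygon_edge P k \<inter> R \<noteq> {}}"

definition open_ray_beyond :: "complex \<Rightarrow> complex \<Rightarrow> complex set" where
  "open_ray_beyond x y = {y + t *\<^sub>R (y - x) |t. t > 0}"

definition Tail :: "complex list \<Rightarrow> nat \<Rightarrow> nat \<Rightarrow> nat" where
  "Tail P i j = crossings P i j (open_ray_beyond (P ! j) (P ! i))"

definition Body :: "complex list \<Rightarrow> nat \<Rightarrow> nat \<Rightarrow> nat" where
  "Body P i j = crossings P i j (open_segment (P ! i) (P ! j))"

definition Head :: "complex list \<Rightarrow> nat \<Rightarrow> nat \<Rightarrow> nat" where
  "Head P i j = crossings P i j (open_ray_beyond (P ! i) (P ! j))"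

definition label_pairs :: "complex list \<Rightarrow> (nat \<times> nat) set" where
  "label_pairs P = {(i, j). i < length P \<and> j < length P \<and> i \<noteq> j}"

text \<open>The parities are recorded as the graph of a function on the label pairs.\<close>

definition pure_parity_information ::
    "complex list \<Rightarrow> ((nat \<times> nat) \<times> bool \<times> bool \<times> bool) set" where
  "pure_parity_information P =
    {((i, j), even (Tail P i j), even (Body P i j), even (Head P i j)) |i j.
       (i, j) \<in> label_pairs P}"

definition visibility_edges :: "complex list \<Rightarrow> (nat \<times> nat) set" where
  "visibility_edges P = {(i, j) \<in> label_pairs P. Body P i j = 0}"

definition hull_edges :: "complex list \<Rightarrow> (nat \<times> nat) set" where
  "hull_edges P =
    {(i, j) \<in> label_pairs P. closed_segment (P ! i) (P ! j) edge_of (convex hull (set P))}"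

end

theory Submission imports Defs begin

text \<open>Let three vertices, no two of which are joined by a polygon edge, change their orientation. On
  the line through two of them, only crossings by the two edges at the third one are affected, and
  each of the counts changes by an even number. In a crown-shaped hexagon whose middle spike
  (label 2) lies just below or just above the segment between the outer spikes (labels 0 and 4), this
  segment is an unobstructed hull edge in the first case and is crossed twice in the second.\<close>

section \<open>Orientation of three points\<close>

text \<open>This is twice the signed area of the triangle \<open>a b c\<close>, positive when the
  three points turn counterclockwise.\<close>

definition orient :: "complex \<Rightarrow> complex \<Rightarrow> complex \<Rightarrow> real" where
  "orient a b c = (Re b - Re a) * (Im c - Im a) - (Im b - Im a) * (Re c - Re a)"

lemma orient_convex_combination:
  "orient a b ((1 - s) *\<^sub>R c + s *\<^sub>R d) = (1 - s) * orient a b c + s * orient a b d"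
  by (simp add: orient_def algebra_simps)

lemma orient_on_line: "orient a b (a + t *\<^sub>R (b - a)) = 0"
  by (simp add: orient_def algebra_simps)

lemma orient_on_segment: "z \<in> closed_segment a b \<Longrightarrow> orient a b z = 0"
  unfolding closed_segment_def by (auto simp: orient_convex_combination) (simp_all add: orient_def)

lemma not_collinear_if_orient:
  assumes "orient a b c \<noteq> 0"
  shows "\<not> collinear {a, b, c}"
proof
  assume "collinear {a, b, c}"
  then obtain u where u: "\<And>x y. x \<in> {a, b, c} \<Longrightarrow> y \<in> {a, b, c} \<Longrightarrow> \<exists>r. x - y = r *\<^sub>R u"
    unfolding collinear_def by metis
  obtain r s where "b - a = r *\<^sub>R u" "c - a = s *\<^sub>R u"
    using u[of b a] u[of c a] by auto
  then have "b = a + r *\<^sub>R u" "c = a + s *\<^sub>R u"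
    by (auto simp: algebra_simps)
  with assms show False
    by (simp add: orient_def)
qed


section \<open>Crossings as orientation tests\<close>

text \<open>\<open>D\<close> is the cross product of \<open>b - a\<close> and \<open>d - c\<close>,
  so it vanishes exactly when these directions are parallel. The sign condition says that
  \<open>c\<close> and \<open>d\<close> are not strictly on the same side of the line, and Cramer's
  rule gives \<open>orient a c d / D\<close> as the position of the common point on the line. The
  assumption excludes a segment contained in the line.\<close>

lemma closed_segment_meets_line_iff:
  assumes "orient a b c \<noteq> 0 \<or> orient a b d \<noteq> 0"
  defines "D \<equiv> orient a b d - orient a b c"
  shows "closed_segment c d \<inter> {a + t *\<^sub>R (b - a) |t. t \<in> T} \<noteq> {} \<longleftrightarrow>
    D \<noteq> 0 \<and> orient a b c * orient a b d \<le> 0 \<and> orient a c d / D \<in> T"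
    (is "?l \<longleftrightarrow> ?r")
proof
  assume ?l
  then obtain s t where s: "0 \<le> s" "s \<le> 1" and t: "t \<in> T"
    and eq: "(1 - s) *\<^sub>R c + s *\<^sub>R d = a + t *\<^sub>R (b - a)"
    unfolding closed_segment_def by blast
  have o: "(1 - s) * orient a b c + s * orient a b d = 0"
    using orient_convex_combination[of a b s c d] orient_on_line[of a b t] eq by simp
  have D: "D \<noteq> 0"
    using o assms(1) by (auto simp: D_def algebra_simps)
  have sD: "s * D = - orient a b c"
    using o by (simp add: D_def algebra_simps)
  have "orient a b c * orient a b d = - (s * (1 - s)) * D\<^sup>2"
  proof -
    have "orient a b c = - (s * D)" "orient a b d = (1 - s) * D"
      using sD by (auto simp: D_def algebra_simps)
    then show ?thesis
      by (simp add: power2_eq_square)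
  qed
  then have le: "orient a b c * orient a b d \<le> 0"
    using s by (simp add: mult_nonneg_nonneg)
  have re: "(1 - s) * Re c + s * Re d = Re a + t * (Re b - Re a)"
    and im: "(1 - s) * Im c + s * Im d = Im a + t * (Im b - Im a)"
    using arg_cong[OF eq, of Re] arg_cong[OF eq, of Im] by auto
  have "Re c - Re a = t * (Re b - Re a) - s * (Re d - Re c)"
       "Im c - Im a = t * (Im b - Im a) - s * (Im d - Im c)"
    using re im by (auto simp: algebra_simps)
  note diffs = this
  \<comment> \<open>Replacing \<open>d - a\<close> by \<open>d - c\<close> leaves the cross product
    with \<open>c - a\<close> unchanged; afterwards the part of \<open>c - a\<close> along
    \<open>d - c\<close> drops out.\<close>
  have "orient a c d = (Re c - Re a) * (Im d - Im c) - (Im c - Im a) * (Re d - Re c)"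
    by (simp add: orient_def algebra_simps)
  also have "\<dots> = t * ((Re b - Re a) * (Im d - Im c) - (Im b - Im a) * (Re d - Re c))"
    unfolding diffs by (simp add: algebra_simps)
  finally have "orient a c d = t * ((Re b - Re a) * (Im d - Im c) - (Im b - Im a) * (Re d - Re c))" .
  then have "orient a c d = t * D"
    by (simp add: D_def orient_def algebra_simps)
  with D le t show ?r
    by simp
next
  assume r: ?r
  \<comment> \<open>Cramer's rule gives both parameters of the intersection point.\<close>
  define s where "s = - orient a b c / D"
  define t where "t = orient a c d / D"
  have D: "D \<noteq> 0" and le: "orient a b c * orient a b d \<le> 0" and t: "t \<in> T"
    using r by (auto simp: t_def)
  have sD: "s * D = - orient a b c" and tD: "t * D = orient a c d"
    using D by (auto simp: s_def t_def)
  then have sD': "(1 - s) * D = orient a b d"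
    by (simp add: D_def algebra_simps)
  \<comment> \<open>Multiplying by \<open>D\<^sup>2\<close> yields the sign of \<open>s\<close>
    without a case split on the sign of \<open>D\<close>.\<close>
  have "s * D\<^sup>2 = (s * D) * D"
    by (simp add: power2_eq_square)
  also have "\<dots> = (orient a b c)\<^sup>2 - orient a b c * orient a b d"
    unfolding sD by (simp add: D_def power2_eq_square algebra_simps)
  also have "\<dots> \<ge> 0"
    using le by (simp only: diff_ge_0_iff_ge order_trans[OF _ zero_le_power2])
  finally have "0 \<le> s * D\<^sup>2" .
  then have s0: "0 \<le> s"
    using D by (simp add: zero_le_mult_iff)
  have "(1 - s) * D\<^sup>2 = ((1 - s) * D) * D"
    by (simp add: power2_eq_square)
  also have "\<dots> = (orient a b d)\<^sup>2 - orient a b c * orient a b d"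
    unfolding sD' by (simp add: D_def power2_eq_square algebra_simps)
  also have "\<dots> \<ge> 0"
    using le by (simp only: diff_ge_0_iff_ge order_trans[OF _ zero_le_power2])
  finally have "0 \<le> (1 - s) * D\<^sup>2" .
  then have s1: "s \<le> 1"
    using D by (simp add: zero_le_mult_iff)
  \<comment> \<open>Each coordinate equation is checked after multiplication by \<open>D\<close>,
    where \<open>s * D\<close> and \<open>t * D\<close> are polynomials in the coordinates.\<close>
  have "((1 - s) * Re c + s * Re d - Re a - t * (Re b - Re a)) * D
      = (Re c - Re a) * D + (s * D) * (Re d - Re c) - (t * D) * (Re b - Re a)"
    by (simp add: algebra_simps)
  also have "\<dots> = 0"
    unfolding sD tD by (simp add: D_def orient_def algebra_simps)
  finally have re: "(1 - s) * Re c + s * Re d = Re a + t * (Re b - Re a)"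
    using D by simp
  have "((1 - s) * Im c + s * Im d - Im a - t * (Im b - Im a)) * D
      = (Im c - Im a) * D + (s * D) * (Im d - Im c) - (t * D) * (Im b - Im a)"
    by (simp add: algebra_simps)
  also have "\<dots> = 0"
    unfolding sD tD by (simp add: D_def orient_def algebra_simps)
  finally have im: "(1 - s) * Im c + s * Im d = Im a + t * (Im b - Im a)"
    using D by simp
  have eq: "(1 - s) *\<^sub>R c + s *\<^sub>R d = a + t *\<^sub>R (b - a)"
    using re im by (simp add: complex_eq_iff)
  have "(1 - s) *\<^sub>R c + s *\<^sub>R d \<in> closed_segment c d"
    unfolding closed_segment_def using s0 s1 by blast
  with t eq show ?l by auto
qed

lemma open_segment_parametrized:
  "a \<noteq> b \<Longrightarrow> open_segment a b = {a + t *\<^sub>R (b - a) |t. t \<in> {0<..<1}}"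
  by (auto simp: in_segment algebra_simps)

text \<open>Measuring from \<open>a\<close> towards \<open>b\<close>, as for the open segment, lets
  one intersection criterion serve both; the ray leaves \<open>a\<close> away from \<open>b\<close>,
  hence the negative parameters.\<close>

lemma open_ray_beyond_parametrized: "open_ray_beyond b a = {a + t *\<^sub>R (b - a) |t. t \<in> {..<0}}"
proof (intro set_eqI iffI)
  fix z assume "z \<in> open_ray_beyond b a"
  then obtain t where "z = a + t *\<^sub>R (a - b)" "t > 0"
    unfolding open_ray_beyond_def by auto
  then have "z = a + (- t) *\<^sub>R (b - a)" "- t \<in> {..<0}"
    by (auto simp: algebra_simps)
  then show "z \<in> {a + t *\<^sub>R (b - a) |t. t \<in> {..<0}}" by blast
next
  fix z assume "z \<in> {a + t *\<^sub>R (b - a) |t. t \<in> {..<0}}"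
  then obtain t where "z = a + t *\<^sub>R (b - a)" "t < 0" by auto
  then have "z = a + (- t) *\<^sub>R (a - b)" "- t > 0"
    by (auto simp: algebra_simps)
  then show "z \<in> open_ray_beyond b a"
    unfolding open_ray_beyond_def by blast
qed

section \<open>Crossing counts in integer coordinates\<close>

definition pt :: "int \<times> int \<Rightarrow> complex" where
  "pt p = Complex (of_int (fst p)) (of_int (snd p))"

definition orient_int :: "int \<times> int \<Rightarrow> int \<times> int \<Rightarrow> int \<times> int \<Rightarrow> int" where
  "orient_int a b c = (fst b - fst a) * (snd c - snd a) - (snd b - snd a) * (fst c - fst a)"

lemma pt_eq_iff: "pt p = pt q \<longleftrightarrow> p = q"
  by (simp add: pt_def prod_eq_iff)

lemma orient_pt: "orient (pt a) (pt b) (pt c) = of_int (orient_int a b c)"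
  by (simp add: orient_def pt_def orient_int_def)

definition generic :: "(int \<times> int) list \<Rightarrow> bool" where
  "generic L \<longleftrightarrow> (\<forall>i<length L. \<forall>j<length L. \<forall>k<length L.
     i \<noteq> j \<and> j \<noteq> k \<and> i \<noteq> k \<longrightarrow> orient_int (L ! i) (L ! j) (L ! k) \<noteq> 0)"

lemma general_position_if_generic: "generic L \<Longrightarrow> general_position (map pt L)"
  unfolding generic_def general_position_def
  by (auto intro!: not_collinear_if_orient simp: orient_pt)

text \<open>The line through \<open>a\<close> and \<open>b\<close> meets the line through \<open>c\<close> and \<open>d\<close> at
  \<open>a + (N / D) (b - a)\<close>; the predicate \<open>R\<close> receives \<open>N * D\<close> and \<open>D * D\<close>.\<close>

definition crosses_int ::
    "(int \<Rightarrow> int \<Rightarrow> bool) \<Rightarrow> int \<times> int \<Rightarrow> int \<times> int \<Rightarrow> int \<times> int \<Rightarrow> int \<times> int \<Rightarrow> bool" where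
  "crosses_int R a b c d \<longleftrightarrow>
    (let u = orient_int a b c; v = orient_int a b d; D = v - u; N = orient_int a c d
     in D \<noteq> 0 \<and> u * v \<le> 0 \<and> R (N * D) (D * D))"

definition crossings_int ::
    "(int \<Rightarrow> int \<Rightarrow> bool) \<Rightarrow> (int \<times> int) list \<Rightarrow> nat \<Rightarrow> nat \<Rightarrow> nat" where
  "crossings_int R L i j =
    length (filter (\<lambda>k. {k, Suc k mod length L} \<noteq> {i, j} \<and>
      crosses_int R (L ! i) (L ! j) (L ! k) (L ! (Suc k mod length L))) [0..<length L])"

text \<open>General position puts at least one end of every counted edge off the line through the
  two vertices, so the intersection criterion applies edge by edge. Assumption \<open>T\<close>
  replaces the condition on the quotient \<open>N / D\<close> by a division-free one, obtained by
  scaling with the positive number \<open>D * D\<close>.\<close>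

lemma crossings_pt:
  assumes "generic L" and i: "i < length L" and j: "j < length L" and "i \<noteq> j"
    and T: "\<And>N D :: int. D \<noteq> 0 \<Longrightarrow> of_int N / of_int D \<in> T \<longleftrightarrow> R (N * D) (D * D)"
  shows "crossings (map pt L) i j {pt (L ! i) + t *\<^sub>R (pt (L ! j) - pt (L ! i)) |t. t \<in> T}
    = crossings_int R L i j"
proof -
  define n where "n = length L"
  have "polygon_edge (map pt L) k \<inter> {pt (L ! i) + t *\<^sub>R (pt (L ! j) - pt (L ! i)) |t. t \<in> T} \<noteq> {}
      \<longleftrightarrow> crosses_int R (L ! i) (L ! j) (L ! k) (L ! (Suc k mod n))"
    if k: "k < n" and ne: "{k, Suc k mod n} \<noteq> {i, j}" for k
  proof -
    have k': "Suc k mod n < n" using k by simp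
    \<comment> \<open>The distinct labels \<open>i\<close> and \<open>j\<close> force
      \<open>n\<close> to be at least 2, so wrapping around from \<open>n - 1\<close> to 0 also
      changes the label.\<close>
    have "k \<noteq> Suc k mod n"
      using k i j \<open>i \<noteq> j\<close> by (cases "Suc k = n") (auto simp: n_def)
    with ne have "k \<notin> {i, j} \<or> Suc k mod n \<notin> {i, j}" by auto
    then have "orient_int (L ! i) (L ! j) (L ! k) \<noteq> 0 \<or>
        orient_int (L ! i) (L ! j) (L ! (Suc k mod n)) \<noteq> 0"
      using assms(1) i j k k' \<open>i \<noteq> j\<close> unfolding generic_def n_def by auto
    then have nz: "orient (pt (L ! i)) (pt (L ! j)) (pt (L ! k)) \<noteq> 0 \<or>
        orient (pt (L ! i)) (pt (L ! j)) (pt (L ! (Suc k mod n))) \<noteq> 0"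
      by (simp add: orient_pt)
    have edge: "polygon_edge (map pt L) k = closed_segment (pt (L ! k)) (pt (L ! (Suc k mod n)))"
      using k k' by (simp add: polygon_edge_def n_def)
    define u where "u = orient_int (L ! i) (L ! j) (L ! k)"
    define v where "v = orient_int (L ! i) (L ! j) (L ! (Suc k mod n))"
    define w where "w = orient_int (L ! i) (L ! k) (L ! (Suc k mod n))"
    have "real_of_int u * real_of_int v \<le> 0 \<longleftrightarrow> u * v \<le> 0"
      by (simp flip: of_int_mult)
    then show ?thesis
      using T[of "v - u" w]
      unfolding edge closed_segment_meets_line_iff[OF nz] crosses_int_def Let_def orient_pt
      by (auto simp flip: u_def v_def w_def)
  qed
  then have "{k. k < n \<and> {k, Suc k mod n} \<noteq> {i, j} \<and>
      polygon_edge (map pt L) k \<inter> {pt (L ! i) + t *\<^sub>R (pt (L ! j) - pt (L ! i)) |t. t \<in> T} \<noteq> {}}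
    = {k. k < n \<and> {k, Suc k mod n} \<noteq> {i, j} \<and> crosses_int R (L ! i) (L ! j) (L ! k) (L ! (Suc k mod n))}"
    by blast
  also have "\<dots> = set (filter (\<lambda>k. {k, Suc k mod n} \<noteq> {i, j} \<and>
      crosses_int R (L ! i) (L ! j) (L ! k) (L ! (Suc k mod n))) [0..<n])"
    by auto
  finally show ?thesis
    unfolding crossings_def crossings_int_def
    by (simp add: n_def distinct_card del: set_filter)
qed

context
  fixes L :: "(int \<times> int) list" and i j :: nat
  assumes L: "generic L" and ij: "i < length L" "j < length L" "i \<noteq> j"
begin

text \<open>Scaling 0 < N / D < 1 by \<open>D * D\<close> gives the integer test. Distinctness keeps
  the open segment nondegenerate, as its parametrization requires.\<close>

lemma Body_pt:
  assumes "distinct L"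
  shows "Body (map pt L) i j = crossings_int (\<lambda>r q. 0 < r \<and> r < q) L i j"
proof -
  have "(real_of_int N / real_of_int D \<in> {0<..<1}) = (0 < N * D \<and> N * D < D * D)" if "D \<noteq> 0" for N D
    using that by (cases "D > 0")
      (auto simp: field_simps zero_less_mult_iff mult_less_0_iff zero_less_divide_iff mult_less_cancel_right)
  from crossings_pt[OF L ij this] show ?thesis
    using ij assms by (simp add: Body_def open_segment_parametrized pt_eq_iff nth_eq_iff_index_eq)
qed

lemma Tail_pt: "Tail (map pt L) i j = crossings_int (\<lambda>r q. r < 0) L i j"
proof -
  have "(real_of_int N / real_of_int D \<in> {..<0}) = (N * D < 0)" if "D \<noteq> 0" for N D
    using that by (auto simp: divide_less_0_iff mult_less_0_iff)
  from crossings_pt[OF L ij this] show ?thesis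
    using ij by (simp add: Tail_def open_ray_beyond_parametrized[of "pt (L ! j)" "pt (L ! i)"])
qed

end

section \<open>Simple and counterclockwise polygons\<close>

definition segments_of :: "complex list \<Rightarrow> (complex \<times> complex) list" where
  "segments_of vs = zip vs (tl vs)"

lemma pathstart_polyline: "pathstart (polyline (v # vs)) = v"
  by (induction "v # vs" rule: polyline.induct) auto

lemma pathfinish_polyline: "pathfinish (polyline (v # vs)) = last (v # vs)"
  by (induction "v # vs" arbitrary: v vs rule: polyline.induct) auto

lemma path_image_polyline:
  "path_image (polyline (v # w # vs)) = (\<Union>(c, d) \<in> set (segments_of (v # w # vs)). closed_segment c d)"
proof (induction vs arbitrary: v w)
  case (Cons u vs)
  then show ?case
    by (simp add: segments_of_def path_image_join pathstart_polyline)
qed (simp add: segments_of_def)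

text \<open>A certificate of disjointness by signs alone: one of the segments lies strictly on one
  side of the line through the other.\<close>

definition separated :: "complex \<Rightarrow> complex \<Rightarrow> complex \<Rightarrow> complex \<Rightarrow> bool" where
  "separated a b c d \<longleftrightarrow> orient a b c * orient a b d > 0 \<or> orient c d a * orient c d b > 0"

text \<open>An affine function with the same strict sign at both ends of a segment has no zero on
  it.\<close>

lemma orient_same_side:
  assumes "orient a b c * orient a b d > 0" "z \<in> closed_segment c d"
  shows "orient a b z \<noteq> 0"
proof -
  obtain s where s: "0 \<le> s" "s \<le> 1" "z = (1 - s) *\<^sub>R c + s *\<^sub>R d"
    using assms(2) unfolding closed_segment_def by blast
  have o: "orient a b z = (1 - s) * orient a b c + s * orient a b d"
    unfolding s(3) by (rule orient_convex_combination)
  from assms(1) consider "orient a b c > 0" "orient a b d > 0" | "orient a b c < 0" "orient a b d < 0"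
    by (auto simp: zero_less_mult_iff)
  then show ?thesis
  proof cases
    case 1
    then have "orient a b z > 0"
      unfolding o using s by (cases "s = 0") (auto intro: add_nonneg_pos)
    then show ?thesis by simp
  next
    case 2
    then have "(1 - s) * orient a b c \<le> 0" "s \<noteq> 0 \<Longrightarrow> s * orient a b d < 0"
      using s by (auto simp: mult_nonneg_nonpos mult_pos_neg)
    then have "orient a b z < 0"
      unfolding o using 2 by (cases "s = 0") auto
    then show ?thesis by simp
  qed
qed

lemma separated_disjoint:
  "separated a b c d \<Longrightarrow> closed_segment a b \<inter> closed_segment c d = {}"
  unfolding separated_def using orient_same_side orient_on_segment by blast

text \<open>On the way from \<open>b\<close> to \<open>d\<close> the orientation grows linearly from
  0, so only \<open>b\<close> itself is on the line through \<open>a\<close> and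
  \<open>b\<close>.\<close>

lemma segments_common_endpoint:
  assumes "orient a b d \<noteq> 0"
  shows "closed_segment a b \<inter> closed_segment b d \<subseteq> {b}"
proof
  fix z assume z: "z \<in> closed_segment a b \<inter> closed_segment b d"
  then obtain s where s: "z = (1 - s) *\<^sub>R b + s *\<^sub>R d"
    unfolding closed_segment_def by blast
  have "orient a b z = s * orient a b d"
    unfolding s orient_convex_combination by (simp add: orient_def)
  with z assms have "s = 0"
    using orient_on_segment by fastforce
  with s show "z \<in> {b}" by simp
qed

text \<open>The new first segment meets its neighbour only at \<open>w\<close> because they are not
  collinear, and misses all later segments by separation.\<close>

lemma arc_polyline_Cons:
  assumes arc: "arc (polyline (w # u # vs))" and "orient v w u \<noteq> 0"
    and sep: "\<forall>(c, d) \<in> set (segments_of (u # vs)). separated v w c d"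
  shows "arc (polyline (v # w # u # vs))"
proof -
  have "v \<noteq> w"
    using assms(2) by (auto simp: orient_def)
  moreover have "closed_segment v w \<inter> path_image (polyline (w # u # vs)) \<subseteq> {w}"
    using segments_common_endpoint[OF assms(2)] separated_disjoint sep
    by (fastforce simp: path_image_polyline segments_of_def)
  ultimately show ?thesis
    using arc by (simp add: arc_join_eq pathstart_polyline)
qed

text \<open>This is the step that closes the loop: the first segment may now also touch the final
  one, at their common point \<open>v\<close>.\<close>

lemma simple_path_polyline_Cons:
  assumes arc: "arc (polyline (w # u # vs))" and "orient v w u \<noteq> 0" and "last (u # vs) = v"
    and sep: "\<forall>(c, d) \<in> set (segments_of (u # vs)). separated v w c d \<or> d = v \<and> orient v w c \<noteq> 0"
  shows "simple_path (polyline (v # w # u # vs))"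
proof -
  have "v \<noteq> w"
    using assms(2) by (auto simp: orient_def)
  have "closed_segment v w \<inter> closed_segment c d \<subseteq> {v, w}"
    if cd: "(c, d) \<in> set (segments_of (w # u # vs))" for c d
  proof -
    consider "(c, d) = (w, u)" | "separated v w c d" | "d = v" "orient v w c \<noteq> 0"
      using cd sep by (auto simp: segments_of_def)
    then show ?thesis
    proof cases
      case 1
      then show ?thesis
        using segments_common_endpoint[OF assms(2)] by auto
    next
      case 2
      then show ?thesis
        using separated_disjoint by auto
    next
      case 3
      \<comment> \<open>Reversing the first segment makes \<open>v\<close> the shared middle point,
        as in the lemma on common endpoints.\<close>
      then have "orient w v c \<noteq> 0"
        by (auto simp: orient_def algebra_simps)
      from segments_common_endpoint[OF this] 3 show ?thesis
        by (auto simp: closed_segment_commute)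
    qed
  qed
  then have "closed_segment v w \<inter> path_image (polyline (w # u # vs)) \<subseteq> {v, w}"
    unfolding path_image_polyline by blast
  then show ?thesis
    using arc \<open>v \<noteq> w\<close> assms(3)
    by (simp add: simple_path_join_loop_eq pathstart_polyline pathfinish_polyline insert_commute)
qed

section \<open>Counterclockwise traversal via winding numbers\<close>

text \<open>A segment with \<open>z\<close> strictly to its left turns by a positive angle about
  \<open>z\<close>, and these contributions add up along the joins. Being a path that avoids
  \<open>z\<close> is carried through the induction because additivity requires it.\<close>

lemma winding_number_polyline_pos:
  assumes "\<forall>(c, d) \<in> set (segments_of (v # w # vs)). orient c d z > 0"
  shows "path (polyline (v # w # vs)) \<and> z \<notin> path_image (polyline (v # w # vs)) \<and>
    0 < Re (winding_number (polyline (v # w # vs)) z)"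
  using assms
proof (induction vs arbitrary: v w)
  case Nil
  then have o: "orient v w z > 0"
    by (simp add: segments_of_def)
  then have "0 < Im ((w - v) * cnj (w - z))"
    by (simp add: orient_def algebra_simps)
  with o show ?case
    using winding_number_linepath_pos_lt orient_on_segment by fastforce
next
  case (Cons u vs)
  have o: "orient v w z > 0" and "\<forall>(c, d) \<in> set (segments_of (w # u # vs)). orient c d z > 0"
    using Cons.prems by (auto simp: segments_of_def)
  with Cons.IH have IH: "path (polyline (w # u # vs))" "z \<notin> path_image (polyline (w # u # vs))"
    "0 < Re (winding_number (polyline (w # u # vs)) z)"
    by auto
  have "z \<notin> closed_segment v w"
    using o orient_on_segment by fastforce
  moreover have "0 < Im ((w - v) * cnj (w - z))"
    using o by (simp add: orient_def algebra_simps)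
  then have "0 < Re (winding_number (linepath v w) z)"
    by (rule winding_number_linepath_pos_lt)
  ultimately show ?case
    using IH by (simp add: winding_number_join pathstart_polyline path_image_join)
qed

text \<open>One point suffices: a simple closed path with positive real part of the winding number
  about \<open>z\<close> winds exactly once, so \<open>z\<close> is not outside. The inside is
  connected by the Jordan curve theorem, and the winding number is constant on it.\<close>

lemma counterclockwise_if_pos:
  assumes "simple_polygon P" and "z \<notin> path_image (boundary_path P)"
    and pos: "0 < Re (winding_number (boundary_path P) z)"
  shows "counterclockwise P"
proof -
  define g where "g = boundary_path P"
  obtain v vs where P: "P = v # vs"
    using assms(1) by (cases P) (auto simp: simple_polygon_def)
  have g: "simple_path g" "pathfinish g = pathstart g"
    using assms(1) by (auto simp: simple_polygon_def g_def boundary_path_def P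
        pathstart_polyline pathfinish_polyline)
  have "winding_number g z = 1"
    using simple_closed_path_winding_number_pos[OF g] assms by (simp add: g_def)
  then have z: "z \<in> inside (path_image g)"
    using simple_closed_path_winding_number_cases[OF g] assms(2)
      winding_number_zero_in_outside[OF simple_path_imp_path[OF g(1)] g(2), of z]
    by (auto simp: g_def inside_Un_outside inside_outside)
  have "connected (inside (path_image g))"
    using Jordan_inside_outside[OF g] by blast
  then have "winding_number g y = winding_number g z" if "y \<in> inside (path_image g)" for y
    using winding_number_eq[OF simple_path_imp_path[OF g(1)] g(2) that z]
    by (simp add: inside_no_overlap)
  with \<open>winding_number g z = 1\<close> show ?thesis
    unfolding counterclockwise_def g_def by simp
qed

section \<open>The two crowns\<close>

text \<open>The parameter is the height of the middle spike, the outer spikes being at height 0. The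
  other lines through two vertices meet the vertical axis below height -1, so between
  \<open>e = - 1\<close> and \<open>e = 1\<close> only the triple 0, 2, 4 changes its
  orientation.\<close>

definition crown :: "int \<Rightarrow> (int \<times> int) list" where
  "crown e = [(4, 0), (2, -2), (0, e), (-2, -2), (-4, 0), (0, -6)]"

lemma all_less_6: "(\<forall>i<6. Q i) \<longleftrightarrow> Q 0 \<and> Q 1 \<and> Q 2 \<and> Q 3 \<and> Q 4 \<and> Q (5 :: nat)"
  by (simp add: eval_nat_numeral All_less_Suc conj_ac)

lemma upt_6: "[0..<6] = [0, 1, 2, 3, 4, 5]"
  by (simp add: upt_rec)

lemma length_crown: "length (crown e) = 6"
  by (simp add: crown_def)

lemma distinct_crown: "e \<noteq> - 6 \<Longrightarrow> distinct (crown e)"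
  by (simp add: crown_def)

lemma generic_crown: "e = 1 \<or> e = - 1 \<Longrightarrow> generic (crown e)"
  unfolding generic_def length_crown all_less_6 by (auto simp: crown_def orient_int_def)

lemma simple_polygon_crown:
  assumes "e = 1 \<or> e = - 1"
  shows "simple_polygon (map pt (crown e))"
  unfolding simple_polygon_def boundary_path_def crown_def
  using assms unfolding list.map append.simps list.sel
  \<comment> \<open>The first edge closes the loop; the remaining ones are peeled off as arcs down
    to a single segment.\<close>
  by (intro conjI simple_path_polyline_Cons arc_polyline_Cons)
    (auto simp: segments_of_def separated_def orient_pt orient_int_def arc_linepath pt_eq_iff)

lemma counterclockwise_crown:
  assumes "e = 1 \<or> e = - 1"
  shows "counterclockwise (map pt (crown e))"
proof (rule counterclockwise_if_pos)
  \<comment> \<open>the crown is star-shaped about this point\<close>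
  let ?z = "pt (0, -5)"
  have "0 < Re (winding_number (boundary_path (map pt (crown e))) ?z) \<and>
    ?z \<notin> path_image (boundary_path (map pt (crown e)))"
    unfolding boundary_path_def crown_def list.map append.simps list.sel
    using assms
    by (intro winding_number_polyline_pos conjI winding_number_polyline_pos[THEN conjunct2, THEN conjunct1]
      winding_number_polyline_pos[THEN conjunct2, THEN conjunct2])
       (auto simp: segments_of_def orient_pt orient_int_def)
  then show "0 < Re (winding_number (boundary_path (map pt (crown e))) ?z)"
    "?z \<notin> path_image (boundary_path (map pt (crown e)))" by auto
qed (rule simple_polygon_crown[OF assms])

section \<open>Parities of the crossing counts\<close>

lemma nth_crown:
  "crown e ! 0 = (4, 0)" "crown e ! Suc 0 = (2, - 2)" "crown e ! 2 = (0, e)"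
  "crown e ! 3 = (- 2, - 2)" "crown e ! 4 = (- 4, 0)" "crown e ! 5 = (0, - 6)"
  by (simp_all add: crown_def)

lemma Suc_mod_6:
  "Suc 0 mod 6 = 1" "Suc 1 mod 6 = 2" "Suc 2 mod 6 = 3"
  "Suc 3 mod 6 = 4" "Suc 4 mod 6 = 5" "Suc 5 mod 6 = 0"
  by simp_all

text \<open>As an explicit sum of six indicators, one per edge, the count can be evaluated term by
  term for given labels.\<close>

lemma crossings_int_crown:
  "crossings_int R (crown e) i j =
    (\<Sum>(k, l) \<leftarrow> [(0, 1), (1, 2), (2, 3), (3, 4), (4, 5), (5, 0)].
      of_bool ({k, l} \<noteq> {i, j} \<and>
        crosses_int R (crown e ! i) (crown e ! j) (crown e ! k) (crown e ! l)))"
proof -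
  have length_filter: "length (filter P xs) = (\<Sum>k \<leftarrow> xs. of_bool (P k))" for P and xs :: "nat list"
    by (induction xs) auto
  show ?thesis
    unfolding crossings_int_def length_filter length_crown upt_6
    by (simp only: list.map prod.case Suc_mod_6)
qed

text \<open>Restricted to explicit pairs, so that the simplifier does not unfold the test before the
  vertices of the crown are known.\<close>

lemma crosses_int_pair:
  "crosses_int R (a, a') (b, b') (c, c') (d, d') \<longleftrightarrow>
    (let u = orient_int (a, a') (b, b') (c, c'); v = orient_int (a, a') (b, b') (d, d');
         D = v - u; N = orient_int (a, a') (c, c') (d, d')
     in D \<noteq> 0 \<and> u * v \<le> 0 \<and> R (N * D) (D * D))"
  by (simp add: crosses_int_def)

lemmas crossings_crown = crossings_int_crown nth_crown doubleton_eq_iff crosses_int_pair orient_int_def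

text \<open>A finite check over ordered label pairs. The counts differ only for the labels 0 and 4,
  where the middle spike at height 1 adds two crossings.\<close>

lemma even_Body_crown:
  assumes "i < 6" "j < 6" "i \<noteq> j"
  shows "even (crossings_int (\<lambda>r q. 0 < r \<and> r < q) (crown 1) i j) =
    even (crossings_int (\<lambda>r q. 0 < r \<and> r < q) (crown (- 1)) i j)"
proof -
  have "i \<in> {0, 1, 2, 3, 4, 5}" "j \<in> {0, 1, 2, 3, 4, 5}"
    using assms by auto
  then show ?thesis
    using assms(3) by (elim insertE emptyE; hypsubst) (simp_all add: crossings_crown)
qed

text \<open>The counts differ only at \<open>(2, 0)\<close> and \<open>(2, 4)\<close>: the ray
  leaving the lowered middle spike away from one outer spike crosses both edges at the other, while
  the ray from the raised spike crosses none.\<close>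

lemma even_Tail_crown:
  assumes "i < 6" "j < 6" "i \<noteq> j"
  shows "even (crossings_int (\<lambda>r q. r < 0) (crown 1) i j) =
    even (crossings_int (\<lambda>r q. r < 0) (crown (- 1)) i j)"
proof -
  have "i \<in> {0, 1, 2, 3, 4, 5}" "j \<in> {0, 1, 2, 3, 4, 5}"
    using assms by auto
  then show ?thesis
    using assms(3) by (elim insertE emptyE; hypsubst) (simp_all add: crossings_crown)
qed

lemma pure_parity_information_crown:
  "pure_parity_information (map pt (crown 1)) = pure_parity_information (map pt (crown (- 1)))"
proof -
  \<comment> \<open>Reversing the pair turns heads into tails, so two of the three parities
    suffice.\<close>
  have Head: "Head P i j = Tail P j i" for P i j
    by (simp add: Head_def Tail_def crossings_def insert_commute)
  have "even (Body (map pt (crown 1)) i j) = even (Body (map pt (crown (- 1))) i j)"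
    "even (Tail (map pt (crown 1)) i j) = even (Tail (map pt (crown (- 1))) i j)"
    if "i < 6" "j < 6" "i \<noteq> j" for i j
    using that even_Body_crown even_Tail_crown
    by (simp_all add: Body_pt Tail_pt generic_crown length_crown distinct_crown)
  then show ?thesis
    unfolding pure_parity_information_def label_pairs_def Head by (auto simp: length_crown)
qed

lemma visibility_edges_crown:
  "(0, 4) \<notin> visibility_edges (map pt (crown 1))"
  "(0, 4) \<in> visibility_edges (map pt (crown (- 1)))"
proof -
  have "crossings_int (\<lambda>r q. 0 < r \<and> r < q) (crown 1) 0 4 = 2"
    "crossings_int (\<lambda>r q. 0 < r \<and> r < q) (crown (- 1)) 0 4 = 0"
    by (simp_all add: crossings_crown)
  then show "(0, 4) \<notin> visibility_edges (map pt (crown 1))"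
    "(0, 4) \<in> visibility_edges (map pt (crown (- 1)))"
    by (simp_all add: visibility_edges_def label_pairs_def Body_pt generic_crown length_crown
        distinct_crown)
qed

section \<open>Hull edges\<close>

text \<open>A face containing an interior point of a segment of the hull contains both ends of that
  segment. The origin is such a point between the middle spike and the bottom vertex, yet the spike
  is off the candidate edge.\<close>

lemma not_hull_edge_crown: "(0, 4) \<notin> hull_edges (map pt (crown 1))"
proof
  let ?P = "map pt (crown 1)"
  assume "(0, 4) \<in> hull_edges ?P"
  then have f: "closed_segment (pt (4,0)) (pt (-4,0)) face_of convex hull (set ?P)"
    by (simp add: hull_edges_def edge_of_def crown_def)
  have "pt (0,1) \<in> convex hull (set ?P)" "pt (0,-6) \<in> convex hull (set ?P)"
    by (auto intro!: hull_inc simp: crown_def)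
  moreover have "pt (0,0) \<in> open_segment (pt (0,1)) (pt (0,-6))"
    \<comment> \<open>The origin is at distance 1 from the spike on a segment of length 7.\<close>
    by (auto simp: in_segment pt_def complex_eq_iff intro!: exI[of _ "1/7"])
  moreover have "pt (0,0) \<in> closed_segment (pt (4,0)) (pt (-4,0))"
    by (auto simp: in_segment pt_def complex_eq_iff intro!: exI[of _ "1/2"])
  ultimately have "pt (0,1) \<in> closed_segment (pt (4,0)) (pt (-4,0))"
    using face_ofD[OF f] by blast
  then show False
    by (auto simp: in_segment pt_def complex_eq_iff)
qed

text \<open>The outer spikes lie on the real axis and the other vertices strictly below it, so the
  affine hull of the former misses the convex hull of the latter; this makes their segment a
  face.\<close>

lemma hull_edge_crown: "(0, 4) \<in> hull_edges (map pt (crown (- 1)))"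
proof -
  let ?P = "map pt (crown (- 1))"
  let ?S = "{pt (4, 0), pt (-4, 0)}"
  \<comment> \<open>\<open>\<i> \<bullet> z\<close> is the imaginary part of
    \<open>z\<close>.\<close>
  have "affine hull ?S \<subseteq> {z. \<i> \<bullet> z = 0}"
    using affine_hyperplane[of \<i> 0] by (intro hull_minimal) (auto simp: pt_def)
  moreover have "convex hull (set ?P - ?S) \<subseteq> {z. \<i> \<bullet> z < 0}"
    using convex_halfspace_lt[of \<i> 0] by (intro hull_minimal) (auto simp: pt_def crown_def)
  ultimately have "affine hull ?S \<inter> convex hull (set ?P - ?S) = {}"
    by fastforce
  then have "convex hull ?S face_of convex hull (set ?P)"
    by (intro face_of_convex_hulls) (auto simp: crown_def)
  \<comment> \<open>Distinct ends give the face dimension 1, as an edge must have.\<close>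
  moreover have "pt (4, 0) \<noteq> pt (-4, 0)"
    by (simp add: pt_def)
  ultimately show ?thesis
    by (simp add: hull_edges_def edge_of_def crown_def label_pairs_def segment_convex_hull aff_dim_convex_hull aff_dim_2)
qed

theorem mainTheorem4:
  "\<exists>P P' :: complex list.
     simple_polygon P \<and> general_position P \<and> counterclockwise P \<and>
     simple_polygon P' \<and> general_position P' \<and> counterclockwise P' \<and>
     length P = length P' \<and>
     pure_parity_information P = pure_parity_information P' \<and>
     hull_edges P \<noteq> hull_edges P' \<and>
     visibility_edges P \<noteq> visibility_edges P'"
  using simple_polygon_crown counterclockwise_crown generic_crown general_position_if_generic
    pure_parity_information_crown hull_edge_crown not_hull_edge_crown visibility_edges_crown
  by (intro exI[of _ "map pt (crown 1)"] exI[of _ "map pt (crown (- 1))"]) (auto simp: length_crown)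

end
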